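(* Let $d\in\mathbb{N}\cup\{\infty\}$ and let $X=\{x_1,\dots,x_n\}$ and $Y=\{y_1,\dots,y_n\}$ be two subsets of the unit ball $\mathbb{B}_d$, each consisting of $n$ distinct points. Define $r=\max\{\|z\|:z\in X\cup Y\}$, and the $n\times n$ matrices $A=\left[\frac{1}{1-\langle x_i,x_j\rangle}\right]_{i,j}$ and $B=\left[\frac{1}{1-\langle y_i,y_j\rangle}\right]_{i,j}$. Then $$\delta_{RK}(\mathcal{H}_X,\mathcal{H}_Y)\le\left(1+\frac{4nr(1-r^2)^{-2}}{\min\{\lambda_{\min}(A),\lambda_{\min}(B)\}}\,\rho_s(X,Y)\right)^2,$$ where $\lambda_{\min}(\cdot)$ denotes the minimal eigenvalue of a matrix, and $\rho_s$ is the symmetric distance induced by the Euclidean (norm) metric $\rho$ on $\mathbb{B}_d$.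
   Context: $\mathbb{B}_d$ is the open unit ball of a complex $d$-dimensional Hilbert space. For $X\subseteq\mathbb{B}_d$, $\mathcal{H}_X$ is the reproducing kernel Hilbert space (RKHS) on $X$ with kernel $k(z,w)=\frac{1}{1-\langle z,w\rangle}$, $z,w\in X$ (the restriction to $X$ of the Drury-Arveson space). For RKHSs $\mathcal{H}_i$ on sets $X_i$ with kernel functions $k^i_x$ ($i=1,2$), an RKHS isomorphism is a bounded linear bijection $T:\mathcal{H}_1\to\mathcal{H}_2$ with $T(k^1_x)=\lambda_xk^2_{F(x)}$ for all $x\in X_1$, where $F:X_1\to X_2$ is a bijection and $x\mapsto\lambda_x\in\mathbb{C}$ is nowhere vanishing. Define $\delta_{RK}(\mathcal{H}_1,\mathcal{H}_2)=\inf\{\|T\|\|T^{-1}\|:T:\mathcal{H}_1\to\mathcal{H}_2\text{ an RKHS isomorphism}\}$. For $n$-point subsets $X=\{x_i\}$, $Y=\{y_i\}$ of a metric space with metric $\rho$, the symmetric distance is $\rho_s(X,Y)=\min_{\sigma\in S_n}\max_i\rho(x_i,y_{\sigma(i)})$. *)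

theory Defs
  imports
    Complex_Main
    "HOL-Library.Extended_Nat"
    "HOL-Library.Extended_Real"
    "HOL-Library.Function_Algebras"
    "HOL-Combinatorics.Permutations"
    "Jordan_Normal_Form.Char_Poly"
begin

text \<open>Hilbert spaces have an explicit carrier \<^term>\<open>V\<close>, a subspace of an ambient complex vector space,
  so that the same notion covers abstract Hilbert spaces and Hilbert spaces of functions on a set.
  Inner products are linear in the first argument; nothing is assumed about them off \<^term>\<open>V\<close>.\<close>

definition ip_norm :: "('v \<Rightarrow> 'v \<Rightarrow> complex) \<Rightarrow> 'v \<Rightarrow> real" where
  "ip_norm ip v = sqrt (Re (ip v v))"

locale complex_hilbert_space = vector_space scale
  for scale :: "complex \<Rightarrow> 'v::ab_group_add \<Rightarrow> 'v" +
  fixes V :: "'v set" and ip :: "'v \<Rightarrow> 'v \<Rightarrow> complex"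
  assumes subspace_V: "subspace V"
    and ip_add: "\<lbrakk>u \<in> V; v \<in> V; w \<in> V\<rbrakk> \<Longrightarrow> ip (u + v) w = ip u w + ip v w"
    and ip_scale: "\<lbrakk>v \<in> V; w \<in> V\<rbrakk> \<Longrightarrow> ip (scale c v) w = c * ip v w"
    and ip_commute: "\<lbrakk>v \<in> V; w \<in> V\<rbrakk> \<Longrightarrow> ip w v = cnj (ip v w)"
    and ip_nonneg: "v \<in> V \<Longrightarrow> 0 \<le> Re (ip v v)"
    and ip_eq_zeroD: "\<lbrakk>v \<in> V; ip v v = 0\<rbrakk> \<Longrightarrow> v = 0"
    and complete_V:
      "\<lbrakk>\<And>m. s m \<in> V;
        \<And>e. e > 0 \<Longrightarrow> \<exists>M. \<forall>m\<ge>M. \<forall>p\<ge>M. ip_norm ip (s m - s p) < e\<rbrakk>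
       \<Longrightarrow> \<exists>l\<in>V. (\<lambda>m. ip_norm ip (s m - l)) \<longlonglongrightarrow> 0"

definition complex_dim :: "(complex \<Rightarrow> 'v::ab_group_add \<Rightarrow> 'v) \<Rightarrow> 'v set \<Rightarrow> enat" where
  "complex_dim scale V =
     (if \<exists>S. finite S \<and> V \<subseteq> module.span scale S then enat (vector_space.dim scale V) else \<infinity>)"

definition open_unit_ball :: "'v set \<Rightarrow> ('v \<Rightarrow> 'v \<Rightarrow> complex) \<Rightarrow> 'v set" where
  "open_unit_ball V ip = {v \<in> V. ip_norm ip v < 1}"

definition fun_scale :: "complex \<Rightarrow> ('a \<Rightarrow> complex) \<Rightarrow> 'a \<Rightarrow> complex" where
  "fun_scale c f = (\<lambda>x. c * f x)"

text \<open>A function on the set \<^term>\<open>X\<close> is represented by its extension by \<open>0\<close> to the whole type, which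
  makes the pointwise operations of the function type the operations on functions on \<^term>\<open>X\<close>.
  Accordingly only the values of \<open>rk_kernel\<close> on points of the set matter.\<close>

record 'a rkhs =
  rk_points :: "'a set"
  rk_space :: "('a \<Rightarrow> complex) set"
  rk_ip :: "('a \<Rightarrow> complex) \<Rightarrow> ('a \<Rightarrow> complex) \<Rightarrow> complex"
  rk_kernel :: "'a \<Rightarrow> 'a \<Rightarrow> complex"

definition kernel_fun :: "'a rkhs \<Rightarrow> 'a \<Rightarrow> 'a \<Rightarrow> complex" where
  "kernel_fun H w = (\<lambda>z. if z \<in> rk_points H then rk_kernel H z w else 0)"

definition is_rkhs :: "'a rkhs \<Rightarrow> bool" where
  "is_rkhs H \<longleftrightarrow>
     complex_hilbert_space fun_scale (rk_space H) (rk_ip H) \<and>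
     (\<forall>f\<in>rk_space H. \<forall>z. z \<notin> rk_points H \<longrightarrow> f z = 0) \<and>
     (\<forall>w\<in>rk_points H. kernel_fun H w \<in> rk_space H \<and>
        (\<forall>f\<in>rk_space H. f w = rk_ip H f (kernel_fun H w)))"

text \<open>By uniqueness in the Moore-Aronszajn theorem, the space is determined by the set and the kernel.\<close>

definition is_drury_arveson_on :: "('v \<Rightarrow> 'v \<Rightarrow> complex) \<Rightarrow> 'v set \<Rightarrow> 'v rkhs \<Rightarrow> bool" where
  "is_drury_arveson_on ip X H \<longleftrightarrow>
     is_rkhs H \<and> rk_points H = X \<and>
     (\<forall>z\<in>X. \<forall>w\<in>X. rk_kernel H z w = 1 / (1 - ip z w))"

abbreviation rk_norm :: "'a rkhs \<Rightarrow> ('a \<Rightarrow> complex) \<Rightarrow> real" where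
  "rk_norm H \<equiv> ip_norm (rk_ip H)"

definition rkhs_iso ::
  "'a rkhs \<Rightarrow> 'b rkhs \<Rightarrow> (('a \<Rightarrow> complex) \<Rightarrow> 'b \<Rightarrow> complex) \<Rightarrow> bool" where
  "rkhs_iso H1 H2 T \<longleftrightarrow>
     bij_betw T (rk_space H1) (rk_space H2) \<and>
     (\<forall>f\<in>rk_space H1. \<forall>g\<in>rk_space H1. T (f + g) = T f + T g) \<and>
     (\<forall>c. \<forall>f\<in>rk_space H1. T (fun_scale c f) = fun_scale c (T f)) \<and>
     (\<exists>C. \<forall>f\<in>rk_space H1. rk_norm H2 (T f) \<le> C * rk_norm H1 f) \<and>
     (\<exists>F lam. bij_betw F (rk_points H1) (rk_points H2) \<and>
        (\<forall>x\<in>rk_points H1. lam x \<noteq> 0 \<and>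
           T (kernel_fun H1 x) = fun_scale (lam x) (kernel_fun H2 (F x))))"

definition op_norm ::
  "'a rkhs \<Rightarrow> 'b rkhs \<Rightarrow> (('a \<Rightarrow> complex) \<Rightarrow> 'b \<Rightarrow> complex) \<Rightarrow> ereal" where
  "op_norm H1 H2 T = (SUP f\<in>{f \<in> rk_space H1. rk_norm H1 f \<le> 1}. ereal (rk_norm H2 (T f)))"

text \<open>The infimum is taken in the extended reals, so it is \<open>\<infinity>\<close> if there is no isomorphism.\<close>

definition delta_RK :: "'a rkhs \<Rightarrow> 'b rkhs \<Rightarrow> ereal" where
  "delta_RK H1 H2 =
     (INF T\<in>{T. rkhs_iso H1 H2 T}.
        op_norm H1 H2 T * op_norm H2 H1 (inv_into (rk_space H1) T))"

definition symmetric_distance ::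
  "('v \<Rightarrow> 'v \<Rightarrow> real) \<Rightarrow> nat \<Rightarrow> (nat \<Rightarrow> 'v) \<Rightarrow> (nat \<Rightarrow> 'v) \<Rightarrow> real" where
  "symmetric_distance \<rho> n x y =
     (MIN \<sigma>\<in>{\<sigma>. \<sigma> permutes {..<n}}. MAX i\<in>{..<n}. \<rho> (x i) (y (\<sigma> i)))"

definition kernel_matrix :: "('v \<Rightarrow> 'v \<Rightarrow> complex) \<Rightarrow> nat \<Rightarrow> (nat \<Rightarrow> 'v) \<Rightarrow> complex mat" where
  "kernel_matrix ip n x = mat n n (\<lambda>(i, j). 1 / (1 - ip (x i) (x j)))"

text \<open>Meant for Hermitian matrices, all of whose eigenvalues are real.\<close>

definition lambda_min :: "complex mat \<Rightarrow> real" where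
  "lambda_min A = Min {a. eigenvalue A (complex_of_real a)}"

end

theory Submission
  imports Defs
begin

text \<open>Match the points optimally and send the kernel function of \<open>x\<^sub>i\<close> to that of its partner;
  this is well defined because the kernel functions of distinct points of the ball are linearly
  independent. On coefficient vectors \<open>c\<close> the squared norms of the two spaces are the quadratic
  forms of the two kernel matrices. Their entries differ by at most
  \<open>M = 2r\<rho>\<^sub>s / (1 - r\<^sup>2)\<^sup>2\<close>, so the forms differ by at most \<open>n M \<bar>c\<bar>\<^sup>2\<close>. This is at most
  \<open>n M / \<lambda>\<close> times either form, where \<open>\<lambda>\<close> is the smaller of the two least eigenvalues. Hence
  both operator norms are at most the square root of \<open>1 + n M / \<lambda>\<close>.\<close>

section \<open>Quadratic forms\<close>

text \<open>The existence of the two spaces makes the kernel matrices positive semidefinite, but not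
  definite, and the difference is what matters: definiteness makes the map between the spaces well
  defined and the eigenvalue in the denominator positive. It has to be extracted from the shape of
  the kernel on the ball. The link between forms and matrices is one inequality for semidefinite
  \<open>K\<close>: the squared norm of \<open>K c\<close> is at most a constant times the form at
  \<open>c\<close>. It identifies the null vectors of the form with those of the matrix, and it
  makes the infimum of the Rayleigh quotient an eigenvalue. With \<open>e = n M / \<lambda>\<close>,
  the product of the two operator norms is at most \<open>1 + e\<close>; the theorem states the
  larger bound \<open>(1 + 2 * e)\<^sup>2\<close>.\<close>

definition sesq_form ::
  "nat \<Rightarrow> (nat \<Rightarrow> nat \<Rightarrow> complex) \<Rightarrow> (nat \<Rightarrow> complex) \<Rightarrow> (nat \<Rightarrow> complex) \<Rightarrow> complex" where
  "sesq_form n K c d = (\<Sum>i<n. \<Sum>j<n. cnj (c i) * K i j * d j)"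

definition quad_form :: "nat \<Rightarrow> (nat \<Rightarrow> nat \<Rightarrow> complex) \<Rightarrow> (nat \<Rightarrow> complex) \<Rightarrow> real" where
  "quad_form n K c = Re (sesq_form n K c c)"

definition apply_kernel ::
  "nat \<Rightarrow> (nat \<Rightarrow> nat \<Rightarrow> complex) \<Rightarrow> (nat \<Rightarrow> complex) \<Rightarrow> nat \<Rightarrow> complex" where
  "apply_kernel n K c i = (\<Sum>j<n. K i j * c j)"

definition sq_norm :: "nat \<Rightarrow> (nat \<Rightarrow> complex) \<Rightarrow> real" where
  "sq_norm n c = (\<Sum>i<n. (cmod (c i))\<^sup>2)"

definition hermitian_kernel :: "nat \<Rightarrow> (nat \<Rightarrow> nat \<Rightarrow> complex) \<Rightarrow> bool" where
  "hermitian_kernel n K \<longleftrightarrow> (\<forall>i<n. \<forall>j<n. K j i = cnj (K i j))"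

text \<open>\<open>quad_form\<close> discards the imaginary part, so its sign does not force
  symmetry; the Hermitian condition is imposed separately.\<close>

definition psd_kernel :: "nat \<Rightarrow> (nat \<Rightarrow> nat \<Rightarrow> complex) \<Rightarrow> bool" where
  "psd_kernel n K \<longleftrightarrow> hermitian_kernel n K \<and> (\<forall>c. 0 \<le> quad_form n K c)"

section \<open>Bounds for Hermitian and semidefinite forms\<close>

lemma sq_norm_nonneg: "0 \<le> sq_norm n c"
  by (simp add: sq_norm_def sum_nonneg)

lemma sq_norm_eq_0_iff: "sq_norm n c = 0 \<longleftrightarrow> (\<forall>i<n. c i = 0)"
  by (auto simp: sq_norm_def sum_nonneg_eq_0_iff)

lemma of_real_sq_norm: "complex_of_real (sq_norm n c) = (\<Sum>i<n. c i * cnj (c i))"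
  unfolding sq_norm_def of_real_sum complex_norm_square by (rule refl)

lemma sesq_form_apply_kernel: "sesq_form n K c d = (\<Sum>i<n. cnj (c i) * apply_kernel n K d i)"
  by (simp add: sesq_form_def apply_kernel_def sum_distrib_left mult.assoc)

lemma sesq_form_apply_self:
  "sesq_form n K (apply_kernel n K c) c = complex_of_real (sq_norm n (apply_kernel n K c))"
  by (simp add: sesq_form_apply_kernel of_real_sq_norm mult.commute)

lemma sesq_form_commute:
  assumes "hermitian_kernel n K"
  shows "sesq_form n K d c = cnj (sesq_form n K c d)"
proof -
  have "sesq_form n K d c = (\<Sum>j<n. \<Sum>i<n. cnj (d i) * K i j * c j)"
    unfolding sesq_form_def by (rule sum.swap)
  also have "\<dots> = (\<Sum>j<n. \<Sum>i<n. cnj (cnj (c j) * K j i * d i))"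
  proof (intro sum.cong refl)
    fix i j assume "i \<in> {..<n}" "j \<in> {..<n}"
    then have "K i j = cnj (K j i)" using assms unfolding hermitian_kernel_def by blast
    then show "cnj (d i) * K i j * c j = cnj (cnj (c j) * K j i * d i)" by simp
  qed
  finally show ?thesis unfolding sesq_form_def by simp
qed

lemma sesq_form_diff_left:
  "sesq_form n K (\<lambda>i. c i - complex_of_real t * b i) d = sesq_form n K c d - of_real t * sesq_form n K b d"
  unfolding sesq_form_def sum_distrib_left sum_subtractf[symmetric]
  by (intro sum.cong refl) (simp add: algebra_simps)

lemma sesq_form_diff_right:
  "sesq_form n K d (\<lambda>i. c i - complex_of_real t * b i) = sesq_form n K d c - of_real t * sesq_form n K d b"
  unfolding sesq_form_def sum_distrib_left sum_subtractf[symmetric]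
  by (intro sum.cong refl) (simp add: algebra_simps)

text \<open>Up to a factor, \<open>K c\<close> is the gradient of the form at \<open>c\<close>. The
  form is evaluated after a gradient step of length \<open>t\<close>, for use with
  \<open>t = 1 / L\<close>.\<close>

lemma quad_form_diff_apply:
  assumes "hermitian_kernel n K"
  shows "quad_form n K (\<lambda>i. c i - complex_of_real t * apply_kernel n K c i) =
    quad_form n K c - 2 * t * sq_norm n (apply_kernel n K c) + t\<^sup>2 * quad_form n K (apply_kernel n K c)"
proof -
  have "sesq_form n K c (apply_kernel n K c) = complex_of_real (sq_norm n (apply_kernel n K c))"
    by (subst sesq_form_commute[OF assms]) (simp add: sesq_form_apply_self)
  then show ?thesis
    unfolding quad_form_def sesq_form_diff_left sesq_form_diff_right sesq_form_apply_self
    by (simp add: algebra_simps power2_eq_square)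
qed

text \<open>The arithmetic-geometric mean inequality for \<open>cmod (c i) * cmod (c j)\<close>
  turns the double sum into \<open>n\<close> copies of the squared norm. This is the source of the
  factor \<open>n\<close> in the theorem.\<close>

lemma cmod_sesq_form_le:
  assumes "\<And>i j. i < n \<Longrightarrow> j < n \<Longrightarrow> cmod (K i j) \<le> M" and "0 \<le> M"
  shows "cmod (sesq_form n K c c) \<le> real n * M * sq_norm n c"
proof -
  have "cmod (sesq_form n K c c) \<le> (\<Sum>i<n. \<Sum>j<n. cmod (cnj (c i) * K i j * c j))"
    unfolding sesq_form_def by (intro order_trans[OF norm_sum] sum_mono norm_sum)
  also have "\<dots> \<le> (\<Sum>i<n. \<Sum>j<n. M * (((cmod (c i))\<^sup>2 + (cmod (c j))\<^sup>2) / 2))"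
  proof (intro sum_mono)
    fix i j assume "i \<in> {..<n}" "j \<in> {..<n}"
    then have "cmod (K i j) * (cmod (c i) * cmod (c j)) \<le> M * (cmod (c i) * cmod (c j))"
      using assms by (intro mult_right_mono) auto
    also have "\<dots> \<le> M * (((cmod (c i))\<^sup>2 + (cmod (c j))\<^sup>2) / 2)"
      using sum_squares_bound[of "cmod (c i)" "cmod (c j)"] assms(2)
      by (intro mult_left_mono) (auto simp: field_simps)
    finally show "cmod (cnj (c i) * K i j * c j) \<le> M * (((cmod (c i))\<^sup>2 + (cmod (c j))\<^sup>2) / 2)"
      by (simp add: norm_mult mult_ac)
  qed
  also have "\<dots> = M * ((\<Sum>i<n. \<Sum>j<n. (cmod (c i))\<^sup>2 + (cmod (c j))\<^sup>2) / 2)"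
    unfolding sum_distrib_left sum_divide_distrib by (rule refl)
  also have "(\<Sum>i<n. \<Sum>j<n. (cmod (c i))\<^sup>2 + (cmod (c j))\<^sup>2) = 2 * (real n * sq_norm n c)"
    unfolding sum.distrib sq_norm_def by (simp flip: sum_distrib_left)
  also have "M * (2 * (real n * sq_norm n c) / 2) = real n * M * sq_norm n c"
    by simp
  finally show ?thesis .
qed

lemma quad_form_bound: "\<exists>L>0. \<forall>c. \<bar>quad_form n K c\<bar> \<le> L * sq_norm n c"
proof (intro exI conjI allI)
  define M where "M = (\<Sum>i<n. \<Sum>j<n. cmod (K i j))"
  have M: "cmod (K i j) \<le> M" if "i < n" "j < n" for i j
  proof -
    have "cmod (K i j) \<le> (\<Sum>j<n. cmod (K i j))"
      using that by (intro member_le_sum) auto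
    also have "\<dots> \<le> M"
      unfolding M_def using that by (intro member_le_sum) (auto intro: sum_nonneg)
    finally show ?thesis .
  qed
  have M0: "0 \<le> M" by (auto simp: M_def intro!: sum_nonneg)
  \<comment> \<open>The summand \<open>1\<close> keeps the constant positive when all entries are
    zero; it is divided by later.\<close>
  show "0 < real n * M + 1" using M0 by (simp add: add_nonneg_pos)
  fix c
  have "\<bar>quad_form n K c\<bar> \<le> cmod (sesq_form n K c c)"
    unfolding quad_form_def by (rule abs_Re_le_cmod)
  also have "\<dots> \<le> real n * M * sq_norm n c"
    by (rule cmod_sesq_form_le) (use M M0 in auto)
  finally show "\<bar>quad_form n K c\<bar> \<le> (real n * M + 1) * sq_norm n c"
    using sq_norm_nonneg[of n c] by (simp add: algebra_simps)
qed

text \<open>The form is still nonnegative after a gradient step from \<open>c\<close>, so at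
  \<open>c\<close> it is at least the amount by which the step lowers it.\<close>

lemma psd_apply_kernel_bound:
  assumes "psd_kernel n K"
  shows "\<exists>L>0. \<forall>c. sq_norm n (apply_kernel n K c) \<le> L * quad_form n K c"
proof -
  obtain L where L: "L > 0" "\<And>c. \<bar>quad_form n K c\<bar> \<le> L * sq_norm n c"
    using quad_form_bound by metis
  have "sq_norm n (apply_kernel n K c) \<le> L * quad_form n K c" for c
  proof -
    define b where "b = apply_kernel n K c"
    \<comment> \<open>The step length \<open>1 / L\<close> minimises
      \<open>- 2 * t + t\<^sup>2 * L\<close>.\<close>
    have "0 \<le> quad_form n K c - 2 * (1 / L) * sq_norm n b + (1 / L)\<^sup>2 * quad_form n K b"
      using assms quad_form_diff_apply[of n K c "1 / L"] unfolding psd_kernel_def b_def by metis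
    moreover have "(1 / L)\<^sup>2 * quad_form n K b \<le> (1 / L)\<^sup>2 * (L * sq_norm n b)"
      using L(2)[of b] by (intro mult_left_mono) auto
    moreover have "(1 / L)\<^sup>2 * (L * sq_norm n b) = sq_norm n b / L"
      using L(1) by (simp add: power2_eq_square)
    ultimately have "sq_norm n b / L \<le> quad_form n K c" by simp
    then show ?thesis using L(1) by (simp add: b_def field_simps)
  qed
  with L(1) show ?thesis by blast
qed

text \<open>Shows that the null vectors of the form make up a linear space, which the quadratic
  expression alone hides.\<close>

lemma psd_quad_form_eq_0_iff:
  assumes "psd_kernel n K"
  shows "quad_form n K c = 0 \<longleftrightarrow> (\<forall>i<n. apply_kernel n K c i = 0)"
proof
  assume "quad_form n K c = 0"
  moreover obtain L where "\<And>c. sq_norm n (apply_kernel n K c) \<le> L * quad_form n K c"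
    using psd_apply_kernel_bound[OF assms] by metis
  ultimately have "sq_norm n (apply_kernel n K c) \<le> 0" by (metis mult_zero_right)
  then show "\<forall>i<n. apply_kernel n K c i = 0"
    using sq_norm_nonneg[of n "apply_kernel n K c"] by (simp add: sq_norm_eq_0_iff[symmetric])
next
  assume "\<forall>i<n. apply_kernel n K c i = 0"
  then show "quad_form n K c = 0" by (simp add: quad_form_def sesq_form_apply_kernel)
qed

text \<open>The shifted matrix has nonzero determinant, and its inverse is carried over to
  coefficient functions. Used with \<open>e = 0\<close> to solve for coefficients, and at the
  infimum of the Rayleigh quotient to reach a contradiction.\<close>

lemma not_eigenvalue_imp_inverse:
  fixes n :: nat and K :: "nat \<Rightarrow> nat \<Rightarrow> complex"
  defines "A \<equiv> mat n n (\<lambda>(i, j). K i j)"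
  assumes "\<not> eigenvalue A e"
  shows "\<exists>M. (\<forall>i<n. \<forall>c. apply_kernel n M (apply_kernel n (\<lambda>i j. K i j - (if i = j then e else 0)) c) i = c i)
    \<and> (\<forall>i<n. \<forall>c. apply_kernel n (\<lambda>i j. K i j - (if i = j then e else 0)) (apply_kernel n M c) i = c i)"
proof -
  define L where "L = (\<lambda>i j. K i j - (if i = j then e else 0))"
  define C where "C = char_matrix A e"
  have A: "A \<in> carrier_mat n n" by (simp add: A_def)
  then have C: "C \<in> carrier_mat n n" by (simp add: C_def)
  have "det C \<noteq> 0" using assms(2) eigenvalue_det[OF A] by (simp add: C_def)
  from det_non_zero_imp_unit[OF C this, unfolded Units_def, of "()"]
  obtain B where B: "B \<in> carrier_mat n n" and BC: "B * C = 1\<^sub>m n" and CB: "C * B = 1\<^sub>m n"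
    by (auto simp: ring_mat_def)
  have CL: "C $$ (i, j) = L i j" if "i < n" "j < n" for i j
    using that by (auto simp: C_def char_matrix_def A_def L_def)
  define M where "M = (\<lambda>i j. B $$ (i, j))"
  have inv_left: "(\<Sum>k<n. M i k * L k j) = (if i = j then 1 else 0)" if "i < n" "j < n" for i j
  proof -
    have "(B * C) $$ (i, j) = (\<Sum>k<n. M i k * L k j)"
      using that B C CL by (auto simp: scalar_prod_def M_def lessThan_atLeast0)
    then show ?thesis using BC that by simp
  qed
  have inv_right: "(\<Sum>k<n. L i k * M k j) = (if i = j then 1 else 0)" if "i < n" "j < n" for i j
  proof -
    have "(C * B) $$ (i, j) = (\<Sum>k<n. L i k * M k j)"
      using that B C CL by (auto simp: scalar_prod_def M_def lessThan_atLeast0)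
    then show ?thesis using CB that by simp
  qed
  have comp: "apply_kernel n P (apply_kernel n Q c) i = (\<Sum>j<n. (\<Sum>k<n. P i k * Q k j) * c j)"
    for P Q c i
    unfolding apply_kernel_def sum_distrib_left sum_distrib_right
    by (subst sum.swap) (simp add: mult.assoc)
  have "apply_kernel n M (apply_kernel n L c) i = c i" if "i < n" for i c
  proof -
    have "apply_kernel n M (apply_kernel n L c) i = (\<Sum>j<n. (if i = j then 1 else 0) * c j)"
      unfolding comp using that by (intro sum.cong) (auto simp: inv_left)
    also have "\<dots> = (\<Sum>j<n. if i = j then c j else 0)" by (intro sum.cong) auto
    also have "\<dots> = c i" using that by simp
    finally show ?thesis .
  qed
  moreover have "apply_kernel n L (apply_kernel n M c) i = c i" if "i < n" for i c
  proof -
    have "apply_kernel n L (apply_kernel n M c) i = (\<Sum>j<n. (if i = j then 1 else 0) * c j)"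
      unfolding comp using that by (intro sum.cong) (auto simp: inv_right)
    also have "\<dots> = (\<Sum>j<n. if i = j then c j else 0)" by (intro sum.cong) auto
    also have "\<dots> = c i" using that by simp
    finally show ?thesis .
  qed
  ultimately show ?thesis unfolding L_def by blast
qed

text \<open>The kernel on the right is the adjoint of \<open>M\<close> times \<open>M\<close>, so
  the boundedness of \<open>M\<close> reduces to that of a quadratic form.\<close>

lemma sq_norm_apply_kernel:
  "sq_norm n (apply_kernel n M v) = quad_form n (\<lambda>j k. \<Sum>i<n. cnj (M i j) * M i k) v"
proof -
  have "complex_of_real ((cmod (apply_kernel n M v i))\<^sup>2) =
      (\<Sum>j<n. \<Sum>k<n. cnj (v j) * (cnj (M i j) * M i k) * v k)" for i
  proof -
    have "complex_of_real ((cmod (apply_kernel n M v i))\<^sup>2) =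
        cnj (apply_kernel n M v i) * apply_kernel n M v i"
      unfolding complex_norm_square by (rule mult.commute)
    also have "\<dots> = (\<Sum>j<n. \<Sum>k<n. cnj (M i j * v j) * (M i k * v k))"
      unfolding apply_kernel_def cnj_sum by (rule sum_product)
    finally show ?thesis by (simp add: mult_ac)
  qed
  then have "complex_of_real (sq_norm n (apply_kernel n M v)) =
      (\<Sum>i<n. \<Sum>j<n. \<Sum>k<n. cnj (v j) * (cnj (M i j) * M i k) * v k)"
    unfolding sq_norm_def of_real_sum by simp
  also have "\<dots> = (\<Sum>j<n. \<Sum>i<n. \<Sum>k<n. cnj (v j) * (cnj (M i j) * M i k) * v k)"
    by (rule sum.swap)
  also have "\<dots> = (\<Sum>j<n. \<Sum>k<n. \<Sum>i<n. cnj (v j) * (cnj (M i j) * M i k) * v k)"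
    by (intro sum.cong refl sum.swap)
  also have "\<dots> = sesq_form n (\<lambda>j k. \<Sum>i<n. cnj (M i j) * M i k) v v"
    by (simp add: sesq_form_def sum_distrib_left sum_distrib_right mult.assoc)
  finally show ?thesis by (metis quad_form_def Re_complex_of_real)
qed

lemma sq_norm_apply_kernel_bound: "\<exists>L>0. \<forall>c. sq_norm n (apply_kernel n M c) \<le> L * sq_norm n c"
  using quad_form_bound[of n "\<lambda>j k. \<Sum>i<n. cnj (M i j) * M i k"]
  unfolding sq_norm_apply_kernel by (meson abs_le_D1)

section \<open>Transformation rules for forms, and the least eigenvalue\<close>

lemma quad_form_cong:
  assumes "\<And>i j. i < n \<Longrightarrow> j < n \<Longrightarrow> K i j = K' i j" and "\<And>i. i < n \<Longrightarrow> c i = c' i"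
  shows "quad_form n K c = quad_form n K' c'"
  unfolding quad_form_def sesq_form_def using assms
  by (intro arg_cong[where f = Re] sum.cong refl) auto

lemma quad_form_shift:
  "quad_form n (\<lambda>i j. K i j - (if i = j then complex_of_real t else 0)) c =
    quad_form n K c - t * sq_norm n c"
proof -
  have "sesq_form n (\<lambda>i j. K i j - (if i = j then complex_of_real t else 0)) c c =
      sesq_form n K c c - (\<Sum>i<n. \<Sum>j<n. if i = j then cnj (c i) * t * c j else 0)"
    unfolding sesq_form_def sum_subtractf[symmetric]
    by (intro sum.cong refl) (auto simp: algebra_simps)
  also have "(\<Sum>i<n. \<Sum>j<n. if i = j then cnj (c i) * t * c j else 0) =
      complex_of_real (t * sq_norm n c)"
    by (simp add: of_real_sq_norm sum_distrib_left mult_ac)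
  finally show ?thesis by (simp add: quad_form_def)
qed

lemma quad_form_scale: "quad_form n K (\<lambda>i. z * c i) = (cmod z)\<^sup>2 * quad_form n K c"
proof -
  have "sesq_form n K (\<lambda>i. z * c i) (\<lambda>i. z * c i) = complex_of_real ((cmod z)\<^sup>2) * sesq_form n K c c"
    unfolding complex_norm_square sesq_form_def sum_distrib_left
    by (intro sum.cong refl) (simp add: mult_ac)
  then show ?thesis by (simp add: quad_form_def del: of_real_power)
qed

lemma sq_norm_scale: "sq_norm n (\<lambda>i. z * c i) = (cmod z)\<^sup>2 * sq_norm n c"
  by (simp add: sq_norm_def norm_mult power_mult_distrib sum_distrib_left)

lemma quad_form_diff:
  "quad_form n (\<lambda>i j. K i j - L i j) c = quad_form n K c - quad_form n L c"
  unfolding quad_form_def sesq_form_def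
  by (simp add: algebra_simps sum_subtractf)

text \<open>Reordering the points amounts to reordering the coefficients. So the lower bound by the
  least eigenvalue passes to the reordered kernel without computing the eigenvalues of a permuted
  matrix.\<close>

lemma quad_form_permute:
  assumes "p permutes {..<n}"
  defines "p' \<equiv> inv_into UNIV p"
  shows "quad_form n (\<lambda>i j. K (p i) (p j)) c = quad_form n K (\<lambda>i. c (p' i))"
    and "sq_norm n c = sq_norm n (\<lambda>i. c (p' i))"
proof -
  have inv: "p' (p i) = i" for i unfolding p'_def by (rule permutes_inverses(2)[OF assms(1)])
  have "sesq_form n K (\<lambda>i. c (p' i)) (\<lambda>i. c (p' i)) =
      (\<Sum>i<n. \<Sum>j<n. cnj (c (p' (p i))) * K (p i) j * c (p' j))"
    unfolding sesq_form_def
    by (rule sum.permute[OF assms(1), THEN trans]) (simp add: comp_def)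
  also have "\<dots> = (\<Sum>i<n. \<Sum>j<n. cnj (c (p' (p i))) * K (p i) (p j) * c (p' (p j)))"
    by (rule sum.cong[OF refl], rule sum.permute[OF assms(1), THEN trans]) (simp add: comp_def)
  finally have "sesq_form n K (\<lambda>i. c (p' i)) (\<lambda>i. c (p' i)) =
      (\<Sum>i<n. \<Sum>j<n. cnj (c (p' (p i))) * K (p i) (p j) * c (p' (p j)))" .
  then show "quad_form n (\<lambda>i j. K (p i) (p j)) c = quad_form n K (\<lambda>i. c (p' i))"
    by (simp add: quad_form_def sesq_form_def inv)
  show "sq_norm n c = sq_norm n (\<lambda>i. c (p' i))"
    unfolding sq_norm_def by (subst (2) sum.permute[OF assms(1)]) (simp add: inv)
qed

lemma quad_form_perturbation:
  assumes close: "\<And>i j. i < n \<Longrightarrow> j < n \<Longrightarrow> cmod (L i j - K i j) \<le> M" and "0 \<le> M"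
    and low: "0 < l" "l * sq_norm n c \<le> quad_form n K c"
  shows "quad_form n L c \<le> (1 + real n * M / l) * quad_form n K c"
proof -
  have "quad_form n L c - quad_form n K c = quad_form n (\<lambda>i j. L i j - K i j) c"
    by (rule quad_form_diff[symmetric])
  also have "\<dots> \<le> cmod (sesq_form n (\<lambda>i j. L i j - K i j) c c)"
    unfolding quad_form_def by (rule complex_Re_le_cmod)
  also have "\<dots> \<le> real n * M * sq_norm n c"
    by (rule cmod_sesq_form_le) (use close assms(2) in simp_all)
  also have "\<dots> \<le> real n * M * (quad_form n K c / l)"
    using low assms(2) by (intro mult_left_mono) (simp_all add: field_simps)
  finally show ?thesis by (simp add: algebra_simps)
qed

text \<open>The infimum of the Rayleigh quotient is an eigenvalue: otherwise the shifted form, being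
  nonnegative with an invertible matrix, would be bounded below by a positive multiple of the
  norm.\<close>

lemma lambda_min_hermitian:
  fixes n :: nat and K :: "nat \<Rightarrow> nat \<Rightarrow> complex"
  defines "A \<equiv> mat n n (\<lambda>(i, j). K i j)"
  assumes herm: "hermitian_kernel n K" and n: "n \<ge> 1"
  shows "eigenvalue A (complex_of_real (lambda_min A))"
    and "lambda_min A * sq_norm n c \<le> quad_form n K c"
proof -
  define S where "S = quad_form n K ` {c. sq_norm n c = 1}"
  define \<mu> where "\<mu> = Inf S"
  obtain L where L: "L > 0" "\<And>c. \<bar>quad_form n K c\<bar> \<le> L * sq_norm n c"
    using quad_form_bound by metis
  have bdd: "bdd_below S"
  proof (rule bdd_belowI)
    fix s assume "s \<in> S"
    then obtain c where "sq_norm n c = 1" "s = quad_form n K c" by (auto simp: S_def)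
    then show "- L \<le> s" using L(2)[of c] by simp
  qed
  \<comment> \<open>A unit vector, available because \<open>n\<close> is at least 1; it keeps the
    infimum from running over the empty set.\<close>
  have "sq_norm n (\<lambda>i. if i = 0 then 1 else 0) = 1"
  proof -
    have "sq_norm n (\<lambda>i. if i = 0 then 1 else 0) = (\<Sum>i<n. if i = 0 then 1 else 0)"
      unfolding sq_norm_def by (intro sum.cong) auto
    then show ?thesis using n by simp
  qed
  then have nonempty: "S \<noteq> {}" by (auto simp: S_def)
  have mu: "\<mu> * sq_norm n c \<le> quad_form n K c" for c
  proof (cases "sq_norm n c = 0")
    case True
    with L(2)[of c] show ?thesis by simp
  next
    case False
    then have pos: "sq_norm n c > 0" using sq_norm_nonneg[of n c] by simp
    define t where "t = complex_of_real (1 / sqrt (sq_norm n c))"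
    have t: "(cmod t)\<^sup>2 = 1 / sq_norm n c"
      using pos by (simp add: t_def power_divide norm_divide)
    have "sq_norm n (\<lambda>i. t * c i) = 1" using pos by (simp add: sq_norm_scale t)
    then have "quad_form n K (\<lambda>i. t * c i) \<in> S" by (auto simp: S_def)
    then have "\<mu> \<le> quad_form n K (\<lambda>i. t * c i)" unfolding \<mu>_def using bdd by (rule cInf_lower)
    then show ?thesis using pos by (simp add: quad_form_scale t field_simps)
  qed
  define K' where "K' = (\<lambda>i j. K i j - (if i = j then complex_of_real \<mu> else 0))"
  have psd: "psd_kernel n K'"
    unfolding psd_kernel_def
  proof (intro conjI allI)
    show "hermitian_kernel n K'"
      unfolding hermitian_kernel_def
    proof (intro allI impI)
      fix i j assume "i < n" "j < n"
      then have "cnj (K i j) = K j i" using herm unfolding hermitian_kernel_def by metis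
      then show "K' j i = cnj (K' i j)" by (simp add: K'_def)
    qed
    show "0 \<le> quad_form n K' c" for c
      using mu[of c] unfolding K'_def quad_form_shift by simp
  qed
  have ev: "eigenvalue A (complex_of_real \<mu>)"
  proof (rule ccontr)
    assume "\<not> ?thesis"
    then obtain M where M: "\<And>i c. i < n \<Longrightarrow> apply_kernel n M (apply_kernel n K' c) i = c i"
      using not_eigenvalue_imp_inverse[of n K "complex_of_real \<mu>", folded A_def K'_def] by blast
    obtain C where C: "C > 0" "\<And>c. sq_norm n (apply_kernel n M c) \<le> C * sq_norm n c"
      using sq_norm_apply_kernel_bound by metis
    obtain L' where L': "L' > 0" "\<And>c. sq_norm n (apply_kernel n K' c) \<le> L' * quad_form n K' c"
      using psd_apply_kernel_bound[OF psd] by metis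
    \<comment> \<open>\<open>C\<close> bounds the inverse of the shifted matrix and
      \<open>L'\<close> bounds its image by the shifted form, so on unit vectors the shifted form is
      at least \<open>1 / (C * L')\<close>.\<close>
    have "\<mu> + 1 / (C * L') \<le> Inf S"
    proof (rule cInf_greatest[OF nonempty])
      fix s assume "s \<in> S"
      then obtain c where c: "sq_norm n c = 1" "s = quad_form n K c" by (auto simp: S_def)
      have "1 = sq_norm n (apply_kernel n M (apply_kernel n K' c))"
        using M c(1) by (simp add: sq_norm_def)
      also have "\<dots> \<le> C * (L' * quad_form n K' c)"
        using C(1) by (intro order_trans[OF C(2)] mult_left_mono L'(2)) auto
      also have "quad_form n K' c = s - \<mu>"
        unfolding K'_def quad_form_shift by (simp add: c)
      finally show "\<mu> + 1 / (C * L') \<le> s" using C(1) L'(1) by (simp add: field_simps)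
    qed
    moreover have "0 < 1 / (C * L')" using C(1) L'(1) by simp
    ultimately show False by (simp add: \<mu>_def)
  qed
  have A: "A \<in> carrier_mat n n" by (simp add: A_def)
  \<comment> \<open>\<open>Min\<close> is informative only on a finite nonempty set. Finiteness
    comes from the roots of the characteristic polynomial, nonemptiness from
    \<open>\<mu>\<close>.\<close>
  have "finite (complex_of_real -` {z. poly (char_poly A) z = 0})"
    using degree_monic_char_poly[OF A] n
    by (intro finite_vimageI poly_roots_finite) (auto simp: inj_on_def)
  also have "complex_of_real -` {z. poly (char_poly A) z = 0} = {a. eigenvalue A (complex_of_real a)}"
    by (auto simp: eigenvalue_root_char_poly[OF A])
  finally have fin: "finite {a. eigenvalue A (complex_of_real a)}" .
  show "eigenvalue A (complex_of_real (lambda_min A))"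
    using Min_in[OF fin] ev unfolding lambda_min_def by auto
  have "lambda_min A \<le> \<mu>" unfolding lambda_min_def using fin ev by (intro Min_le) auto
  then show "lambda_min A * sq_norm n c \<le> quad_form n K c"
    using mu[of c] sq_norm_nonneg[of n c] by (meson mult_right_mono order_trans)
qed

lemma eigenvalue_eigenfunction:
  fixes n :: nat and K :: "nat \<Rightarrow> nat \<Rightarrow> complex"
  assumes "eigenvalue (mat n n (\<lambda>(i, j). K i j)) e"
  obtains c where "sq_norm n c \<noteq> 0" and "\<And>i. i < n \<Longrightarrow> apply_kernel n K c i = e * c i"
proof -
  obtain v where v: "v \<in> carrier_vec n" "v \<noteq> 0\<^sub>v n"
      "mat n n (\<lambda>(i, j). K i j) *\<^sub>v v = e \<cdot>\<^sub>v v"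
    using assms by (auto simp: eigenvalue_def eigenvector_def)
  have "apply_kernel n K (\<lambda>i. v $ i) i = e * v $ i" if "i < n" for i
  proof -
    have "(mat n n (\<lambda>(i, j). K i j) *\<^sub>v v) $ i = apply_kernel n K (\<lambda>i. v $ i) i"
      using that v(1) by (simp add: scalar_prod_def apply_kernel_def lessThan_atLeast0)
    with v that show ?thesis by simp
  qed
  moreover have "sq_norm n (\<lambda>i. v $ i) \<noteq> 0"
    unfolding sq_norm_eq_0_iff using v(1,2) by (auto intro!: eq_vecI)
  ultimately show ?thesis using that by blast
qed

definition pos_def_kernel :: "nat \<Rightarrow> (nat \<Rightarrow> nat \<Rightarrow> complex) \<Rightarrow> bool" where
  "pos_def_kernel n K \<longleftrightarrow> psd_kernel n K \<and> (\<forall>c. quad_form n K c = 0 \<longrightarrow> (\<forall>i<n. c i = 0))"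

text \<open>Pairing an eigenvector with its image gives the eigenvalue times the squared norm. The
  value 0 yields invertibility of the kernel matrix, and \<open>lambda_min\<close> the positive
  denominator of the bound.\<close>

lemma pos_def_eigenvalue_pos:
  assumes "pos_def_kernel n K" and "eigenvalue (mat n n (\<lambda>(i, j). K i j)) (complex_of_real a)"
  shows "0 < a"
proof -
  obtain c where c: "sq_norm n c \<noteq> 0"
    "\<And>i. i < n \<Longrightarrow> apply_kernel n K c i = complex_of_real a * c i"
    using eigenvalue_eigenfunction[OF assms(2)] by blast
  have "sesq_form n K c c = complex_of_real (a * sq_norm n c)"
    by (simp add: sesq_form_apply_kernel c(2) of_real_sq_norm sum_distrib_left mult_ac)
  then have q: "quad_form n K c = a * sq_norm n c" by (simp add: quad_form_def)
  have "0 \<le> quad_form n K c" "quad_form n K c \<noteq> 0"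
    using assms(1) c(1) by (auto simp: pos_def_kernel_def psd_kernel_def sq_norm_eq_0_iff)
  with sq_norm_nonneg[of n c] show ?thesis unfolding q
    by (metis less_eq_real_def mult_le_0_iff not_less mult_eq_0_iff)
qed

section \<open>Positivity of the Drury-Arveson kernel\<close>

context complex_hilbert_space
begin

section \<open>Inner product geometry and the kernel estimate\<close>

lemma ip_zero_left: "w \<in> V \<Longrightarrow> ip 0 w = 0"
  using ip_scale[of w w 0] by simp

lemma ip_diff_left: "\<lbrakk>u \<in> V; v \<in> V; w \<in> V\<rbrakk> \<Longrightarrow> ip (u - v) w = ip u w - ip v w"
  using ip_add[of "u - v" v w] subspace_diff[OF subspace_V] by simp

lemma ip_add_right: "\<lbrakk>u \<in> V; v \<in> V; w \<in> V\<rbrakk> \<Longrightarrow> ip u (v + w) = ip u v + ip u w"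
  using ip_add[of v w u] ip_commute subspace_add[OF subspace_V] by (metis complex_cnj_add)

lemma ip_diff_right: "\<lbrakk>u \<in> V; v \<in> V; w \<in> V\<rbrakk> \<Longrightarrow> ip u (v - w) = ip u v - ip u w"
  using ip_diff_left[of v w u] ip_commute subspace_diff[OF subspace_V] by (metis complex_cnj_diff)

lemma ip_scale_right: "\<lbrakk>v \<in> V; w \<in> V\<rbrakk> \<Longrightarrow> ip v (scale c w) = cnj c * ip v w"
  using ip_scale[of w v c] ip_commute subspace_scale[OF subspace_V] by (metis complex_cnj_mult)

lemma ip_self: "v \<in> V \<Longrightarrow> ip v v = complex_of_real ((ip_norm ip v)\<^sup>2)"
  using ip_commute[of v v] ip_nonneg[of v]
  by (simp add: ip_norm_def complex_eq_iff del: of_real_power)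

lemma ip_norm_nonneg: "v \<in> V \<Longrightarrow> 0 \<le> ip_norm ip v"
  using ip_nonneg by (simp add: ip_norm_def)

lemma ip_norm_eq_0: "v \<in> V \<Longrightarrow> ip_norm ip v = 0 \<Longrightarrow> v = 0"
  using ip_self ip_eq_zeroD by force

lemma ip_norm_pos: "v \<in> V \<Longrightarrow> v \<noteq> 0 \<Longrightarrow> 0 < ip_norm ip v"
  using ip_norm_nonneg[of v] ip_norm_eq_0[of v] by force

text \<open>\<open>P u\<close> is the component of \<open>u\<close> orthogonal to \<open>w\<close>.
  With \<open>u = v\<close> this gives the Cauchy-Schwarz inequality; over a family of vectors it
  splits a rank-one summand off the Gram matrix.\<close>

lemma ip_project:
  assumes "u \<in> V" "v \<in> V" "w \<in> V" "w \<noteq> 0"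
  defines "P \<equiv> \<lambda>u. u - scale (ip u w / ip w w) w"
  shows "ip u v = ip u w * ip w v / ip w w + ip (P u) (P v)"
proof -
  have w: "ip w w \<noteq> 0" using ip_eq_zeroD assms by blast
  have "cnj (ip w w) = ip w w" "cnj (ip v w) = ip w v"
    using ip_commute[of w w] ip_commute[of v w] assms by simp_all
  then show ?thesis
    using w assms(1-3) unfolding P_def
    by (simp add: ip_diff_left ip_diff_right ip_scale ip_scale_right subspace_diff[OF subspace_V]
        subspace_scale[OF subspace_V] field_simps)
qed

lemma cauchy_schwarz:
  assumes "u \<in> V" "w \<in> V"
  shows "cmod (ip u w) \<le> ip_norm ip u * ip_norm ip w"
proof (cases "w = 0")
  case True
  then show ?thesis using assms ip_commute[of 0 u] ip_zero_left ip_norm_nonneg by simp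
next
  case False
  define p where "p = u - scale (ip u w / ip w w) w"
  have p: "p \<in> V"
    using assms by (simp add: p_def subspace_diff[OF subspace_V] subspace_scale[OF subspace_V])
  have pos: "0 < ip_norm ip w"
    using False assms by (intro ip_norm_pos)
  have "ip u w * ip w u = complex_of_real ((cmod (ip u w))\<^sup>2)"
    using assms ip_commute[of u w] complex_norm_square by metis
  moreover have "ip u u = ip u w * ip w u / ip w w + ip p p"
    using ip_project[OF assms(1,1,2) False] unfolding p_def .
  ultimately have "complex_of_real ((ip_norm ip u)\<^sup>2) =
      complex_of_real ((cmod (ip u w))\<^sup>2 / (ip_norm ip w)\<^sup>2 + (ip_norm ip p)\<^sup>2)"
    unfolding ip_self[OF assms(1)] ip_self[OF assms(2)] ip_self[OF p] of_real_add of_real_divide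
    by argo
  then have "(ip_norm ip u)\<^sup>2 = (cmod (ip u w))\<^sup>2 / (ip_norm ip w)\<^sup>2 + (ip_norm ip p)\<^sup>2"
    by (rule of_real_eq_iff[THEN iffD1])
  then have "(cmod (ip u w))\<^sup>2 / (ip_norm ip w)\<^sup>2 \<le> (ip_norm ip u)\<^sup>2" by simp
  then have "(cmod (ip u w))\<^sup>2 \<le> (ip_norm ip u * ip_norm ip w)\<^sup>2"
    using pos by (simp add: field_simps)
  then show ?thesis
    by (rule power2_le_imp_le) (simp add: assms ip_norm_nonneg)
qed

lemma ip_sum_right:
  assumes "f \<in> V" and "\<And>i. i \<in> I \<Longrightarrow> g i \<in> V"
  shows "ip f (\<Sum>i\<in>I. scale (a i) (g i)) = (\<Sum>i\<in>I. cnj (a i) * ip f (g i))"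
  using assms(2)
proof (induction I rule: infinite_finite_induct)
  case (infinite I)
  then show ?case using ip_scale_right[of f f 0] assms(1) by simp
next
  case empty
  then show ?case using ip_scale_right[of f f 0] assms(1) by simp
next
  case (insert i I)
  have "scale (a i) (g i) \<in> V" "(\<Sum>i\<in>I. scale (a i) (g i)) \<in> V"
    using insert.prems by (auto intro!: subspace_sum[OF subspace_V] subspace_scale[OF subspace_V])
  then show ?case
    using insert assms(1) by (simp add: ip_add_right ip_scale_right)
qed

text \<open>Origin of the constant \<open>M\<close>. The difference of the fractions has numerator
  \<open>ip (u - u') v + ip u' (v - v')\<close>, of modulus at most \<open>2 * r * s\<close>, and by
  Cauchy-Schwarz each factor of the denominator has modulus at least
  \<open>1 - r\<^sup>2\<close>.\<close>

lemma kernel_diff_bound: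
  assumes V: "u \<in> V" "v \<in> V" "u' \<in> V" "v' \<in> V"
    and r: "ip_norm ip u \<le> r" "ip_norm ip v \<le> r" "ip_norm ip u' \<le> r" "ip_norm ip v' \<le> r" "r < 1"
    and s: "ip_norm ip (u - u') \<le> s" "ip_norm ip (v - v') \<le> s"
  shows "cmod (1 / (1 - ip u v) - 1 / (1 - ip u' v')) \<le> 2 * r * s / (1 - r\<^sup>2)\<^sup>2"
proof -
  have r0: "0 \<le> r" using ip_norm_nonneg[OF V(1)] r(1) by linarith
  have s0: "0 \<le> s" using ip_norm_nonneg[OF subspace_diff[OF subspace_V V(1,3)]] s(1) by linarith
  have r1: "0 < 1 - r\<^sup>2" using r0 r(5) by (simp add: power_less_one_iff)
  have low: "1 - r\<^sup>2 \<le> cmod (1 - ip a b)"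
    if "a \<in> V" "b \<in> V" "ip_norm ip a \<le> r" "ip_norm ip b \<le> r" for a b
  proof -
    have "cmod (ip a b) \<le> ip_norm ip a * ip_norm ip b" using that by (intro cauchy_schwarz)
    also have "\<dots> \<le> r * r" using that r0 ip_norm_nonneg by (intro mult_mono) simp_all
    finally have "cmod (ip a b) \<le> r\<^sup>2" by (simp add: power2_eq_square)
    then show ?thesis using norm_triangle_ineq2[of 1 "ip a b"] by simp
  qed
  have "ip u v - ip u' v' = ip (u - u') v + ip u' (v - v')"
    using V by (simp add: ip_diff_left ip_diff_right)
  then have "cmod (ip u v - ip u' v') \<le> cmod (ip (u - u') v) + cmod (ip u' (v - v'))"
    by (metis norm_triangle_ineq)
  also have "\<dots> \<le> ip_norm ip (u - u') * ip_norm ip v + ip_norm ip u' * ip_norm ip (v - v')"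
    using V subspace_diff[OF subspace_V] by (intro add_mono cauchy_schwarz) simp_all
  also have "\<dots> \<le> s * r + r * s"
    using V r s r0 s0 ip_norm_nonneg subspace_diff[OF subspace_V]
    by (intro add_mono mult_mono) simp_all
  finally have num: "cmod (ip u v - ip u' v') \<le> 2 * r * s" by simp
  have L: "1 - r\<^sup>2 \<le> cmod (1 - ip u v)" "1 - r\<^sup>2 \<le> cmod (1 - ip u' v')"
    using low V r by blast+
  then have "1 - ip u v \<noteq> 0" "1 - ip u' v' \<noteq> 0" using r1 by force+
  then have "1 / (1 - ip u v) - 1 / (1 - ip u' v') =
      (ip u v - ip u' v') / ((1 - ip u v) * (1 - ip u' v'))"
    by (simp add: field_simps)
  then have "cmod (1 / (1 - ip u v) - 1 / (1 - ip u' v')) =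
      cmod (ip u v - ip u' v') / (cmod (1 - ip u v) * cmod (1 - ip u' v'))"
    by (simp add: norm_divide norm_mult)
  also have "\<dots> \<le> 2 * r * s / ((1 - r\<^sup>2) * (1 - r\<^sup>2))"
    using num L r1 r0 s0 by (intro frac_le mult_mono) simp_all
  finally show ?thesis by (simp add: power2_eq_square)
qed

section \<open>Entrywise products with Gram matrices\<close>

lemma quad_form_gram_project:
  assumes u: "\<And>i. i < n \<Longrightarrow> u i \<in> V" and w: "w \<in> V" "w \<noteq> 0"
  shows "quad_form n (\<lambda>i j. ip (u i) (u j) * K i j) c =
      quad_form n K (\<lambda>j. ip w (u j) * c j) / (ip_norm ip w)\<^sup>2 +
      quad_form n (\<lambda>i j. ip (u i - scale (ip (u i) w / ip w w) w) (u j - scale (ip (u j) w / ip w w) w)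
        * K i j) c"
proof -
  let ?p = "\<lambda>v. v - scale (ip v w / ip w w) w"
  \<comment> \<open>Entrywise multiplication by a rank-one matrix is absorbed into the coefficients:
    each \<open>c j\<close> acquires the factor \<open>ip w (u j)\<close>.\<close>
  have "sesq_form n (\<lambda>i j. ip (u i) (u j) * K i j) c c =
      sesq_form n K (\<lambda>j. ip w (u j) * c j) (\<lambda>j. ip w (u j) * c j) / complex_of_real ((ip_norm ip w)\<^sup>2)
      + sesq_form n (\<lambda>i j. ip (?p (u i)) (?p (u j)) * K i j) c c"
    unfolding sesq_form_def sum_divide_distrib sum.distrib[symmetric]
  proof (intro sum.cong refl)
    fix i j assume "i \<in> {..<n}" "j \<in> {..<n}"
    then have V: "u i \<in> V" "u j \<in> V" using u by auto
    have "cnj (ip w (u i)) = ip (u i) w" using ip_commute[of w "u i"] V w by simp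
    then show "cnj (c i) * (ip (u i) (u j) * K i j) * c j =
        cnj (ip w (u i) * c i) * K i j * (ip w (u j) * c j) / complex_of_real ((ip_norm ip w)\<^sup>2)
        + cnj (c i) * (ip (?p (u i)) (?p (u j)) * K i j) * c j"
      unfolding ip_project[OF V w] ip_self[OF w(1)]
      by (simp add: algebra_simps add_divide_distrib del: of_real_power)
  qed
  then show ?thesis unfolding quad_form_def by (simp del: of_real_power)
qed

text \<open>Schur product theorem for a Gram matrix. Projecting out one of the vectors
  \<^term>\<open>u i\<close> splits off a rank-one Gram matrix, for which the claim is clear.\<close>

lemma quad_form_gram_nonneg:
  assumes psd: "\<And>c. 0 \<le> quad_form n K c" and u: "\<And>i. i < n \<Longrightarrow> u i \<in> V"
  shows "0 \<le> quad_form n (\<lambda>i j. ip (u i) (u j) * K i j) c"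
  using u
\<comment> \<open>The measure counts the nonzero vectors. Projection along \<open>u k\<close> sends
  \<open>u k\<close> to zero and leaves zero vectors at zero, so the count drops.\<close>
proof (induction "card {i. i < n \<and> u i \<noteq> 0}" arbitrary: u rule: less_induct)
  case less
  show ?case
  proof (cases "\<forall>i<n. u i = 0")
    case True
    then have "quad_form n (\<lambda>i j. ip (u i) (u j) * K i j) c = quad_form n (\<lambda>i j. 0) c"
      using subspace_0[OF subspace_V] by (intro quad_form_cong) (auto simp: ip_zero_left)
    then show ?thesis by (simp add: quad_form_def sesq_form_def)
  next
    case False
    then obtain k where k: "k < n" "u k \<noteq> 0" by blast
    define w where "w = u k"
    define u' where "u' = (\<lambda>i. u i - scale (ip (u i) w / ip w w) w)"
    have w: "w \<in> V" "w \<noteq> 0" using k less.prems by (auto simp: w_def)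
    have u': "u' i \<in> V" if "i < n" for i
      using that less.prems w by (simp add: u'_def subspace_diff[OF subspace_V] subspace_scale[OF subspace_V])
    have "u' k = 0" using ip_eq_zeroD[OF w(1)] w(2) by (auto simp: u'_def w_def)
    moreover have "u' i = 0" if "u i = 0" for i
      using that ip_zero_left[OF w(1)] by (simp add: u'_def)
    ultimately have "{i. i < n \<and> u' i \<noteq> 0} \<subset> {i. i < n \<and> u i \<noteq> 0}" using k by blast
    then have "card {i. i < n \<and> u' i \<noteq> 0} < card {i. i < n \<and> u i \<noteq> 0}"
      by (intro psubset_card_mono) auto
    then have "0 \<le> quad_form n (\<lambda>i j. ip (u' i) (u' j) * K i j) c"
      using less.hyps u' by blast
    moreover have "0 \<le> quad_form n K (\<lambda>j. ip w (u j) * c j) / (ip_norm ip w)\<^sup>2"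
      using psd by simp
    ultimately show ?thesis
      using quad_form_gram_project[of n u w K c, OF less.prems w] unfolding u'_def by linarith
  qed
qed

text \<open>Behind this is an operator bound: the adjoint of multiplication by the functional
  \<open>ip _ w\<close> multiplies the coefficient of the kernel function at \<open>u j\<close> by
  \<open>ip w (u j)\<close>. The nonnegative remainder of the projection is discarded.\<close>

lemma quad_form_multiplier_le:
  assumes psd: "\<And>c. 0 \<le> quad_form n K c" and u: "\<And>i. i < n \<Longrightarrow> u i \<in> V" and w: "w \<in> V"
  shows "quad_form n K (\<lambda>j. ip w (u j) * c j) \<le>
    (ip_norm ip w)\<^sup>2 * quad_form n (\<lambda>i j. ip (u i) (u j) * K i j) c"
proof (cases "w = 0")
  case True
  have "quad_form n K (\<lambda>j. ip w (u j) * c j) = quad_form n K (\<lambda>j. 0)"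
    using True u by (intro quad_form_cong) (auto simp: ip_zero_left)
  then show ?thesis
    using True ip_zero_left[of 0] w by (simp add: quad_form_def sesq_form_def ip_norm_def)
next
  case False
  have "0 \<le> quad_form n (\<lambda>i j. ip (u i - scale (ip (u i) w / ip w w) w)
      (u j - scale (ip (u j) w / ip w w) w) * K i j) c"
    using u w by (intro quad_form_gram_nonneg psd)
      (simp add: subspace_diff[OF subspace_V] subspace_scale[OF subspace_V])
  then have "quad_form n K (\<lambda>j. ip w (u j) * c j) / (ip_norm ip w)\<^sup>2 \<le>
      quad_form n (\<lambda>i j. ip (u i) (u j) * K i j) c"
    using quad_form_gram_project[of n u w K c, OF u w False] by linarith
  moreover have "0 < ip_norm ip w"
    using False w by (intro ip_norm_pos)
  ultimately show ?thesis by (simp add: field_simps)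
qed

lemma ip_open_unit_ball:
  assumes "u \<in> open_unit_ball V ip" "v \<in> open_unit_ball V ip"
  shows "cmod (ip u v) < 1"
proof -
  have *: "u \<in> V" "v \<in> V" "ip_norm ip u < 1" "ip_norm ip v < 1"
    using assms by (auto simp: open_unit_ball_def)
  have "cmod (ip u v) \<le> ip_norm ip u * ip_norm ip v" using * by (intro cauchy_schwarz)
  also have "\<dots> \<le> ip_norm ip u * 1" using * ip_norm_nonneg by (intro mult_left_mono) auto
  finally show ?thesis using * by simp
qed

text \<open>The kernel satisfies \<open>k = 1 + \<langle>\<cdot>,\<cdot>\<rangle> k\<close>. So a null vector of the kernel matrix has
  coefficient sum \<open>0\<close>, and remains a null vector when its entries are multiplied by the values of a
  linear functional at the points. Multiplying by suitable affine functionals, one isolates a single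
  nonzero entry, which contradicts the vanishing of the sum.\<close>

lemma drury_arveson_pos_def:
  assumes x: "\<And>i. i < n \<Longrightarrow> x i \<in> open_unit_ball V ip" and inj: "inj_on x {..<n}"
    and K_def: "K = (\<lambda>i j. 1 / (1 - ip (x i) (x j)))" and psd: "psd_kernel n K"
  shows "pos_def_kernel n K"
proof -
  have nonneg: "0 \<le> quad_form n K c" for c using psd by (simp add: psd_kernel_def)
  have V: "x i \<in> V" if "i < n" for i using x[OF that] by (simp add: open_unit_ball_def)
  have K: "K i j = 1 + ip (x i) (x j) * K i j" if "i < n" "j < n" for i j
  proof -
    have "ip (x i) (x j) \<noteq> 1" using ip_open_unit_ball[OF x x] that by force
    then show ?thesis by (simp add: K_def field_simps)
  qed
  \<comment> \<open>The all-ones matrix contributes the squared modulus of the coefficient sum. Both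
    summands are nonnegative, so each vanishes at a null vector.\<close>
  have split: "quad_form n K c = (cmod (\<Sum>i<n. c i))\<^sup>2 +
      quad_form n (\<lambda>i j. ip (x i) (x j) * K i j) c" for c
  proof -
    have "quad_form n K c = quad_form n (\<lambda>i j. 1 + ip (x i) (x j) * K i j) c"
      using K by (intro quad_form_cong) auto
    moreover have "sesq_form n (\<lambda>i j. 1 + ip (x i) (x j) * K i j) c c =
        (\<Sum>i<n. \<Sum>j<n. cnj (c i) * c j) + sesq_form n (\<lambda>i j. ip (x i) (x j) * K i j) c c"
      unfolding sesq_form_def sum.distrib[symmetric]
      by (intro sum.cong refl) (simp add: algebra_simps)
    moreover have "(\<Sum>i<n. \<Sum>j<n. cnj (c i) * c j) = complex_of_real ((cmod (\<Sum>i<n. c i))\<^sup>2)"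
      unfolding complex_norm_square mult.commute[of "sum c {..<n}"] cnj_sum
      by (rule sum_product[symmetric])
    ultimately show ?thesis by (simp add: quad_form_def del: of_real_power)
  qed
  have sum0: "(\<Sum>i<n. c i) = 0"
    and mult0: "\<And>w. w \<in> V \<Longrightarrow> quad_form n K (\<lambda>j. ip w (x j) * c j) = 0"
    if "quad_form n K c = 0" for c
  proof -
    have gram: "0 \<le> quad_form n (\<lambda>i j. ip (x i) (x j) * K i j) c"
      using nonneg V by (rule quad_form_gram_nonneg)
    then have "(cmod (\<Sum>i<n. c i))\<^sup>2 = 0"
      using split[of c] that zero_le_power2[of "cmod (\<Sum>i<n. c i)"] by linarith
    then show "(\<Sum>i<n. c i) = 0" by simp
    then have "quad_form n (\<lambda>i j. ip (x i) (x j) * K i j) c = 0" using split[of c] that by simp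
    then show "quad_form n K (\<lambda>j. ip w (x j) * c j) = 0" if "w \<in> V" for w
      using quad_form_multiplier_le[of n K x w c, OF nonneg V that]
        nonneg[of "\<lambda>j. ip w (x j) * c j"] by simp
  qed
  \<comment> \<open>Subtracting \<open>b\<close> times \<open>c\<close> is harmless because the null
    vectors form a linear space.\<close>
  have affine: "quad_form n K (\<lambda>j. (ip w (x j) - b) * c j) = 0"
    if "quad_form n K c = 0" "w \<in> V" for w b c
  proof -
    have "apply_kernel n K (\<lambda>j. (ip w (x j) - b) * c j) i =
        apply_kernel n K (\<lambda>j. ip w (x j) * c j) i - b * apply_kernel n K c i" for i
      unfolding apply_kernel_def sum_distrib_left sum_subtractf[symmetric]
      by (intro sum.cong refl) (simp add: algebra_simps)
    then show ?thesis
      using that mult0[OF that] unfolding psd_quad_form_eq_0_iff[OF psd] by simp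
  qed
  have "\<forall>c. quad_form n K c = 0 \<longrightarrow> (\<forall>k<n. c k = 0)"
  proof (rule allI, rule impI, rule ccontr)
    fix c assume c: "quad_form n K c = 0"
    assume "\<not> (\<forall>k<n. c k = 0)"
    then obtain k where k: "k < n" and ck: "c k \<noteq> 0" by blast
    have "\<exists>c'. quad_form n K c' = 0 \<and> c' k \<noteq> 0 \<and> (\<forall>i\<in>S. c' i = 0)"
      if "finite S" "S \<subseteq> {..<n} - {k}" for S
      using that
    proof (induction S rule: finite_induct)
      case empty
      then show ?case using c ck by blast
    next
      case (insert i S)
      then obtain c' where c': "quad_form n K c' = 0" "c' k \<noteq> 0" "\<forall>i\<in>S. c' i = 0" by auto
      \<comment> \<open>As a function of \<open>z\<close>, \<open>ip w z - ip w (x i)\<close>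
        vanishes at \<open>x i\<close> and equals the nonzero number \<open>ip w w\<close> at
        \<open>x k\<close>. Multiplying by it clears entry \<open>i\<close>, keeps entry
        \<open>k\<close> nonzero and leaves the entries in \<open>S\<close> at zero.\<close>
      define w where "w = x k - x i"
      have i: "i < n" "i \<noteq> k" using insert.prems by auto
      then have w: "w \<in> V" using V k by (simp add: w_def subspace_diff[OF subspace_V])
      have "w \<noteq> 0" using inj i k by (auto simp: w_def inj_on_def)
      then have "ip w w \<noteq> 0" using ip_eq_zeroD w by blast
      moreover have "ip w (x k) - ip w (x i) = ip w w"
        using ip_diff_right[OF w V V] i k by (simp add: w_def)
      ultimately have "ip w (x k) - ip w (x i) \<noteq> 0" by metis
      then show ?case
        using affine[OF c'(1) w, of "ip w (x i)"] c'(2,3)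
        by (intro exI[of _ "\<lambda>j. (ip w (x j) - ip w (x i)) * c' j"]) simp
    qed
    from this[of "{..<n} - {k}"] obtain c' where
      c': "quad_form n K c' = 0" "c' k \<noteq> 0" "\<And>i. i \<in> {..<n} - {k} \<Longrightarrow> c' i = 0" by auto
    have "(\<Sum>i<n. c' i) = c' k + (\<Sum>i\<in>{..<n} - {k}. c' i)"
      using k by (intro sum.remove) simp_all
    also have "(\<Sum>i\<in>{..<n} - {k}. c' i) = 0"
      using c'(3) by (intro sum.neutral ballI)
    finally show False using sum0[OF c'(1)] c'(2) by simp
  qed
  with psd show ?thesis unfolding pos_def_kernel_def by (rule conjI)
qed

end

section \<open>Reproducing kernel Hilbert spaces on finitely many points\<close>

lemma sum_fun_apply: "(\<Sum>i\<in>I. f i) z = (\<Sum>i\<in>I. f i z)"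
  by (induction I rule: infinite_finite_induct) simp_all

definition kernel_comb :: "'a rkhs \<Rightarrow> nat \<Rightarrow> (nat \<Rightarrow> 'a) \<Rightarrow> (nat \<Rightarrow> complex) \<Rightarrow> 'a \<Rightarrow> complex" where
  "kernel_comb H n x c = (\<Sum>j<n. fun_scale (c j) (kernel_fun H (x j)))"

lemma kernel_comb_cong:
  "(\<And>i. i < n \<Longrightarrow> c i = d i) \<Longrightarrow> kernel_comb H n x c = kernel_comb H n x d"
  unfolding kernel_comb_def by (intro sum.cong) simp_all

lemma kernel_comb_add:
  "kernel_comb H n x (\<lambda>i. c i + d i) = kernel_comb H n x c + kernel_comb H n x d"
  unfolding kernel_comb_def sum.distrib[symmetric]
  by (intro sum.cong) (simp_all add: fun_scale_def fun_eq_iff algebra_simps)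

lemma kernel_comb_scale:
  "kernel_comb H n x (\<lambda>i. a * c i) = fun_scale a (kernel_comb H n x c)"
  by (rule ext) (simp add: kernel_comb_def fun_scale_def sum_fun_apply sum_distrib_left mult.assoc)

lemma kernel_comb_delta:
  assumes "k < n"
  shows "kernel_comb H n x (\<lambda>i. if i = k then 1 else 0) = kernel_fun H (x k)"
proof (rule ext)
  fix z
  have "kernel_comb H n x (\<lambda>i. if i = k then 1 else 0) z =
      (\<Sum>i<n. if i = k then kernel_fun H (x i) z else 0)"
    unfolding kernel_comb_def sum_fun_apply by (intro sum.cong) (simp_all add: fun_scale_def)
  then show "kernel_comb H n x (\<lambda>i. if i = k then 1 else 0) z = kernel_fun H (x k) z"
    using assms by simp
qed

text \<open>The enumeration and the matrix are parameters because the second space is viewed under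
  two orderings of its points, as given and as matched.\<close>

locale finite_rkhs =
  fixes H :: "'a rkhs" and n :: nat and x :: "nat \<Rightarrow> 'a" and K :: "nat \<Rightarrow> nat \<Rightarrow> complex"
  assumes rkhs: "is_rkhs H" and points: "rk_points H = x ` {..<n}" and inj: "inj_on x {..<n}"
    and kernel: "\<And>i j. i < n \<Longrightarrow> j < n \<Longrightarrow> rk_kernel H (x i) (x j) = K i j"
begin

sublocale complex_hilbert_space fun_scale "rk_space H" "rk_ip H"
  using rkhs by (simp add: is_rkhs_def)

lemma kernel_fun_in: "i < n \<Longrightarrow> kernel_fun H (x i) \<in> rk_space H"
  using rkhs points by (simp add: is_rkhs_def)

lemma reproducing: "f \<in> rk_space H \<Longrightarrow> i < n \<Longrightarrow> rk_ip H f (kernel_fun H (x i)) = f (x i)"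
  using rkhs points by (simp add: is_rkhs_def)

lemma kernel_fun_apply: "i < n \<Longrightarrow> j < n \<Longrightarrow> kernel_fun H (x j) (x i) = K i j"
  using kernel points by (simp add: kernel_fun_def)

lemma rk_space_eqI:
  assumes "f \<in> rk_space H" "g \<in> rk_space H" "\<And>i. i < n \<Longrightarrow> f (x i) = g (x i)"
  shows "f = g"
proof (rule ext)
  fix z
  show "f z = g z"
  proof (cases "z \<in> rk_points H")
    case True
    then show ?thesis using assms(3) points by auto
  next
    case False
    then have "f z = 0" "g z = 0" using rkhs assms(1,2) unfolding is_rkhs_def by blast+
    then show ?thesis by simp
  qed
qed

lemma kernel_comb_in: "kernel_comb H n x c \<in> rk_space H"
  unfolding kernel_comb_def
  by (intro subspace_sum[OF subspace_V] subspace_scale[OF subspace_V] kernel_fun_in) simp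

lemma kernel_comb_apply: "i < n \<Longrightarrow> kernel_comb H n x c (x i) = apply_kernel n K c i"
  by (simp add: kernel_comb_def sum_fun_apply fun_scale_def apply_kernel_def kernel_fun_apply mult.commute)

text \<open>Only the second argument is expanded; the reproducing property evaluates the first at
  the points. Expanding there conjugates the coefficients, which is why \<open>sesq_form\<close>
  conjugates its first slot.\<close>

lemma ip_kernel_comb: "rk_ip H (kernel_comb H n x c) (kernel_comb H n x c) = sesq_form n K c c"
proof -
  have "rk_ip H (kernel_comb H n x c) (kernel_comb H n x c) =
      (\<Sum>i<n. cnj (c i) * rk_ip H (kernel_comb H n x c) (kernel_fun H (x i)))"
    by (subst (2) kernel_comb_def) (intro ip_sum_right kernel_comb_in kernel_fun_in, simp)
  also have "\<dots> = (\<Sum>i<n. cnj (c i) * apply_kernel n K c i)"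
    by (intro sum.cong) (simp_all add: reproducing kernel_comb_in kernel_comb_apply)
  finally show ?thesis by (simp add: sesq_form_apply_kernel)
qed

lemma rk_norm_kernel_comb: "rk_norm H (kernel_comb H n x c) = sqrt (quad_form n K c)"
  by (simp add: ip_norm_def ip_kernel_comb quad_form_def)

text \<open>The form at \<open>c\<close> is the squared norm of a combination of kernel functions,
  so positivity is inherited from the given space.\<close>

lemma psd: "psd_kernel n K"
  unfolding psd_kernel_def hermitian_kernel_def
proof (intro conjI allI impI)
  fix i j assume ij: "i < n" "j < n"
  have ip: "rk_ip H (kernel_fun H (x j)) (kernel_fun H (x i)) = K i j" if "i < n" "j < n" for i j
    using that by (simp add: reproducing kernel_fun_in kernel_fun_apply)
  show "K j i = cnj (K i j)"
    unfolding ip[OF ij, symmetric] ip[OF ij(2,1), symmetric]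
    by (rule ip_commute) (simp_all add: kernel_fun_in ij)
next
  show "0 \<le> quad_form n K c" for c
    using ip_nonneg[OF kernel_comb_in, of c] by (simp add: ip_kernel_comb quad_form_def)
qed

end

section \<open>Coefficients relative to the kernel functions\<close>

locale pos_def_finite_rkhs = finite_rkhs +
  assumes pos_def: "pos_def_kernel n K"
begin

lemma kernel_inverse:
  "\<exists>M. (\<forall>i<n. \<forall>c. apply_kernel n M (apply_kernel n K c) i = c i) \<and>
       (\<forall>i<n. \<forall>c. apply_kernel n K (apply_kernel n M c) i = c i)"
proof -
  have "\<not> eigenvalue (mat n n (\<lambda>(i, j). K i j)) 0"
    using pos_def_eigenvalue_pos[OF pos_def, of 0] by auto
  from not_eigenvalue_imp_inverse[OF this] show ?thesis by (simp only: if_cancel diff_zero)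
qed

text \<open>One inverse of the kernel matrix is fixed and applied to the values at the points, so
  linearity in \<open>f\<close> holds for arbitrary functions.\<close>

definition coeffs :: "('a \<Rightarrow> complex) \<Rightarrow> nat \<Rightarrow> complex" where
  "coeffs f = apply_kernel n (SOME M. (\<forall>i<n. \<forall>c. apply_kernel n M (apply_kernel n K c) i = c i) \<and>
       (\<forall>i<n. \<forall>c. apply_kernel n K (apply_kernel n M c) i = c i)) (\<lambda>i. f (x i))"

lemma coeffs_add: "coeffs (f + g) i = coeffs f i + coeffs g i"
  by (simp add: coeffs_def apply_kernel_def algebra_simps sum.distrib)

lemma coeffs_scale: "coeffs (fun_scale a f) i = a * coeffs f i"
  by (simp add: coeffs_def apply_kernel_def fun_scale_def sum_distrib_left mult.left_commute)

lemma coeffs_kernel_comb: "i < n \<Longrightarrow> coeffs (kernel_comb H n x c) i = c i"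
proof -
  assume i: "i < n"
  let ?M = "SOME M. (\<forall>i<n. \<forall>c. apply_kernel n M (apply_kernel n K c) i = c i) \<and>
       (\<forall>i<n. \<forall>c. apply_kernel n K (apply_kernel n M c) i = c i)"
  \<comment> \<open>The two argument functions are known to agree at indices below \<open>n\<close>,
    which is all that the outer sum sees.\<close>
  have "coeffs (kernel_comb H n x c) i = apply_kernel n ?M (apply_kernel n K c) i"
    unfolding coeffs_def by (subst (1 4) apply_kernel_def) (simp add: kernel_comb_apply)
  also have "\<dots> = c i" using someI_ex[OF kernel_inverse] i by blast
  finally show ?thesis .
qed

lemma kernel_comb_coeffs:
  assumes "f \<in> rk_space H"
  shows "kernel_comb H n x (coeffs f) = f"
proof (rule rk_space_eqI[OF kernel_comb_in assms])
  fix i assume i: "i < n"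
  show "kernel_comb H n x (coeffs f) (x i) = f (x i)"
    unfolding kernel_comb_apply[OF i] coeffs_def
    using someI_ex[OF kernel_inverse] i by blast
qed

end

section \<open>The map that keeps coefficients, and its norm\<close>

locale finite_rkhs_pair =
  H1: pos_def_finite_rkhs H1 n x K + H2: pos_def_finite_rkhs H2 n y L
  for H1 :: "'a rkhs" and H2 :: "'b rkhs" and n x y K L +
  fixes C :: real
  assumes C: "\<And>c. quad_form n L c \<le> C * quad_form n K c"
begin

text \<open>The kernel function at \<open>x i\<close> goes to the one at \<open>y i\<close>, with
  factor 1. The locale compares the forms in one direction; the inverse is the
  \<open>transfer\<close> of the pair taken in the opposite order.\<close>

definition transfer :: "('a \<Rightarrow> complex) \<Rightarrow> 'b \<Rightarrow> complex" where
  "transfer f = kernel_comb H2 n y (H1.coeffs f)"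

lemma transfer_kernel_comb: "transfer (kernel_comb H1 n x c) = kernel_comb H2 n y c"
  unfolding transfer_def by (rule kernel_comb_cong) (rule H1.coeffs_kernel_comb)

lemma rk_norm_transfer_le:
  assumes "f \<in> rk_space H1"
  shows "rk_norm H2 (transfer f) \<le> sqrt C * rk_norm H1 f"
proof -
  have "rk_norm H2 (transfer f) = sqrt (quad_form n L (H1.coeffs f))"
    unfolding transfer_def by (rule H2.rk_norm_kernel_comb)
  also have "\<dots> \<le> sqrt (C * quad_form n K (H1.coeffs f))" by (simp add: C)
  also have "\<dots> = sqrt C * rk_norm H1 (kernel_comb H1 n x (H1.coeffs f))"
    by (simp add: H1.rk_norm_kernel_comb real_sqrt_mult)
  finally show ?thesis by (simp add: H1.kernel_comb_coeffs[OF assms])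
qed

text \<open>Agreement on the space is what is known of \<open>inv_into\<close>, to which this is
  applied as well.\<close>

lemma op_norm_le:
  assumes "0 \<le> C" and "\<And>f. f \<in> rk_space H1 \<Longrightarrow> S f = transfer f"
  shows "op_norm H1 H2 S \<le> ereal (sqrt C)"
  unfolding op_norm_def
proof (rule SUP_least)
  fix f assume f: "f \<in> {f \<in> rk_space H1. rk_norm H1 f \<le> 1}"
  then have "rk_norm H2 (transfer f) \<le> sqrt C * rk_norm H1 f" by (intro rk_norm_transfer_le) simp
  also have "\<dots> \<le> sqrt C * 1" using f assms(1) by (intro mult_left_mono) simp_all
  finally show "ereal (rk_norm H2 (S f)) \<le> ereal (sqrt C)" using f assms(2) by simp
qed

end

text \<open>In the extended reals an empty supremum is minus infinity; the zero function rules this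
  out. Serves as the sign condition when the two norms are multiplied.\<close>

lemma op_norm_nonneg:
  assumes "is_rkhs H1" "\<And>f. f \<in> rk_space H1 \<Longrightarrow> S f \<in> rk_space H2" "is_rkhs H2"
  shows "0 \<le> op_norm H1 H2 S"
proof -
  interpret H1: complex_hilbert_space fun_scale "rk_space H1" "rk_ip H1"
    using assms(1) by (simp add: is_rkhs_def)
  interpret H2: complex_hilbert_space fun_scale "rk_space H2" "rk_ip H2"
    using assms(3) by (simp add: is_rkhs_def)
  have 0: "0 \<in> rk_space H1" by (rule H1.subspace_0[OF H1.subspace_V])
  have "rk_ip H1 0 0 = 0" by (rule H1.ip_zero_left[OF 0])
  then have "0 \<in> {f \<in> rk_space H1. rk_norm H1 f \<le> 1}" using 0 by (simp add: ip_norm_def)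
  moreover have "0 \<le> ereal (rk_norm H2 (S 0))" using H2.ip_norm_nonneg assms(2) 0 by simp
  ultimately show ?thesis unfolding op_norm_def
    by (rule SUP_upper2[where i = 0 and f = "\<lambda>f. ereal (rk_norm H2 (S f))"])
qed

text \<open>Both transfers keep the coefficient vector, so they are inverse to each other. Each norm
  is at most \<open>sqrt C\<close>, whence \<open>C\<close> and not its square.\<close>

lemma delta_RK_le:
  assumes "finite_rkhs_pair H1 H2 n x y K L C" "finite_rkhs_pair H2 H1 n y x L K C" "0 \<le> C"
  shows "delta_RK H1 H2 \<le> ereal C"
proof -
  interpret P: finite_rkhs_pair H1 H2 n x y K L C by (fact assms(1))
  interpret Q: finite_rkhs_pair H2 H1 n y x L K C by (fact assms(2))
  have T_in: "P.transfer f \<in> rk_space H2" for f unfolding P.transfer_def by (rule P.H2.kernel_comb_in)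
  have S_in: "Q.transfer f \<in> rk_space H1" for f unfolding Q.transfer_def by (rule P.H1.kernel_comb_in)
  have ST: "Q.transfer (P.transfer f) = f" if "f \<in> rk_space H1" for f
    using P.transfer_kernel_comb Q.transfer_kernel_comb P.H1.kernel_comb_coeffs[OF that] by metis
  have TS: "P.transfer (Q.transfer f) = f" if "f \<in> rk_space H2" for f
    using P.transfer_kernel_comb Q.transfer_kernel_comb P.H2.kernel_comb_coeffs[OF that] by metis
  have bij: "bij_betw P.transfer (rk_space H1) (rk_space H2)"
    by (rule bij_betw_byWitness[where f' = Q.transfer]) (use ST TS T_in S_in in auto)
  have inv: "inv_into (rk_space H1) P.transfer g = Q.transfer g" if "g \<in> rk_space H2" for g
    using bij S_in TS[OF that] by (intro inv_into_f_eq) (simp_all add: bij_betw_def)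
  define F where "F = (\<lambda>z. y (inv_into {..<n} x z))"
  have F: "F (x i) = y i" if "i < n" for i
    using that P.H1.inj by (simp add: F_def)
  have iso: "rkhs_iso H1 H2 P.transfer"
    unfolding rkhs_iso_def
  proof (intro conjI ballI allI)
    show "bij_betw P.transfer (rk_space H1) (rk_space H2)" by (rule bij)
    show "P.transfer (f + g) = P.transfer f + P.transfer g" for f g
      unfolding P.transfer_def kernel_comb_add[symmetric]
      by (rule kernel_comb_cong) (rule P.H1.coeffs_add)
    show "P.transfer (fun_scale a f) = fun_scale a (P.transfer f)" for a f
      unfolding P.transfer_def kernel_comb_scale[symmetric]
      by (rule kernel_comb_cong) (rule P.H1.coeffs_scale)
    show "\<exists>C. \<forall>f\<in>rk_space H1. rk_norm H2 (P.transfer f) \<le> C * rk_norm H1 f"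
      using P.rk_norm_transfer_le by blast
    have "bij_betw F (rk_points H1) (rk_points H2)"
      unfolding P.H1.points P.H2.points
    proof (rule bij_betw_imageI)
      show "inj_on F (x ` {..<n})"
        using P.H2.inj by (auto simp: inj_on_def F)
      show "F ` x ` {..<n} = y ` {..<n}" unfolding image_image by (simp add: F)
    qed
    moreover have "P.transfer (kernel_fun H1 z) = fun_scale 1 (kernel_fun H2 (F z))" if z: "z \<in> rk_points H1" for z
    proof -
      obtain i where i: "i < n" "z = x i" using z by (auto simp: P.H1.points)
      have "P.transfer (kernel_fun H1 z) = kernel_fun H2 (y i)"
        using P.transfer_kernel_comb[of "\<lambda>j. if j = i then 1 else 0"]
        unfolding kernel_comb_delta[OF i(1)] i(2) .
      then show ?thesis using F i by (simp add: fun_scale_def)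
    qed
    ultimately show "\<exists>F lam. bij_betw F (rk_points H1) (rk_points H2) \<and>
        (\<forall>z\<in>rk_points H1. lam z \<noteq> 0 \<and> P.transfer (kernel_fun H1 z) = fun_scale (lam z) (kernel_fun H2 (F z)))"
      by (intro exI[of _ F] exI[of _ "\<lambda>_. 1"]) simp
  qed
  have "delta_RK H1 H2 \<le> op_norm H1 H2 P.transfer * op_norm H2 H1 (inv_into (rk_space H1) P.transfer)"
    unfolding delta_RK_def using iso by (intro INF_lower) simp
  also have "\<dots> \<le> ereal (sqrt C) * ereal (sqrt C)"
  proof (rule ereal_mult_mono)
    show "0 \<le> op_norm H2 H1 (inv_into (rk_space H1) P.transfer)"
      by (rule op_norm_nonneg[OF P.H2.rkhs _ P.H1.rkhs]) (simp add: inv S_in)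
    show "op_norm H1 H2 P.transfer \<le> ereal (sqrt C)" by (rule P.op_norm_le[OF assms(3) refl])
    show "op_norm H2 H1 (inv_into (rk_space H1) P.transfer) \<le> ereal (sqrt C)"
      by (rule Q.op_norm_le[OF assms(3) inv])
  qed (simp add: assms(3))
  also have "\<dots> = ereal C" using assms(3) by simp
  finally show ?thesis .
qed

theorem proposition5p1:
  fixes scale :: "complex \<Rightarrow> 'v::ab_group_add \<Rightarrow> 'v"
    and V :: "'v set" and ip :: "'v \<Rightarrow> 'v \<Rightarrow> complex"
    and d :: enat and n :: nat
    and x y :: "nat \<Rightarrow> 'v" and X Y :: "'v set"
    and HX HY :: "'v rkhs"
    and r :: real and A B :: "complex mat"
  assumes "complex_hilbert_space scale V ip"
    and "complex_dim scale V = d"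
    and "n \<ge> 1"
    and "X = x ` {..<n}" and "inj_on x {..<n}" and "X \<subseteq> open_unit_ball V ip"
    and "Y = y ` {..<n}" and "inj_on y {..<n}" and "Y \<subseteq> open_unit_ball V ip"
    and "is_drury_arveson_on ip X HX"
    and "is_drury_arveson_on ip Y HY"
    and "r = (MAX z\<in>X \<union> Y. ip_norm ip z)"
    and "A = kernel_matrix ip n x"
    and "B = kernel_matrix ip n y"
  shows "delta_RK HX HY \<le>
    ereal ((1 + 4 * real n * r * (1 - r\<^sup>2) powi (-2) / min (lambda_min A) (lambda_min B)
              * symmetric_distance (\<lambda>u v. ip_norm ip (u - v)) n x y)\<^sup>2)"
proof -
  interpret complex_hilbert_space scale V ip by (fact assms(1))
  define K where "K = (\<lambda>i j. 1 / (1 - ip (x i) (x j)))"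
  define L where "L = (\<lambda>i j. 1 / (1 - ip (y i) (y j)))"
  define l where "l = min (lambda_min A) (lambda_min B)"
  define s where "s = symmetric_distance (\<lambda>u v. ip_norm ip (u - v)) n x y"
  have A: "A = mat n n (\<lambda>(i, j). K i j)" and B: "B = mat n n (\<lambda>(i, j). L i j)"
    unfolding assms(13,14) kernel_matrix_def K_def L_def by (rule refl)+
  have xball: "x i \<in> open_unit_ball V ip" and yball: "y i \<in> open_unit_ball V ip" if "i < n" for i
    using that assms(4,6,7,9) by auto
  have pos_def_X: "pos_def_finite_rkhs HX n x K"
  proof -
    interpret X: finite_rkhs HX n x K
      using assms(4,5,10) by unfold_locales (auto simp: is_drury_arveson_on_def K_def)
    show ?thesis
      by unfold_locales (rule drury_arveson_pos_def[OF xball assms(5) K_def X.psd])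
  qed
  \<comment> \<open>Stated for any enumeration \<open>z\<close>, since it serves both for
    \<open>y\<close> and for its reordering by \<open>p\<close>.\<close>
  have pos_def_Y: "pos_def_finite_rkhs HY n z (\<lambda>i j. 1 / (1 - ip (z i) (z j)))"
    if z: "z ` {..<n} = Y" "inj_on z {..<n}" for z
  proof -
    interpret Y: finite_rkhs HY n z "\<lambda>i j. 1 / (1 - ip (z i) (z j))"
      using z assms(11) by unfold_locales (auto simp: is_drury_arveson_on_def)
    have "z i \<in> open_unit_ball V ip" if "i < n" for i
      using that z(1) assms(9) by auto
    from drury_arveson_pos_def[OF this z(2) refl Y.psd] show ?thesis by unfold_locales
  qed
  interpret X: pos_def_finite_rkhs HX n x K by (fact pos_def_X)
  interpret Y: pos_def_finite_rkhs HY n y L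
    unfolding L_def by (rule pos_def_Y) (simp_all add: assms(7,8))
  have herm: "hermitian_kernel n K" "hermitian_kernel n L"
    using X.psd Y.psd by (simp_all add: psd_kernel_def)
  have "0 < lambda_min A"
    using pos_def_eigenvalue_pos[OF X.pos_def] lambda_min_hermitian(1)[OF herm(1) assms(3)]
    unfolding A by blast
  moreover have "0 < lambda_min B"
    using pos_def_eigenvalue_pos[OF Y.pos_def] lambda_min_hermitian(1)[OF herm(2) assms(3)]
    unfolding B by blast
  ultimately have l: "0 < l" by (simp add: l_def)
  have lK: "l * sq_norm n c \<le> quad_form n K c" for c
  proof -
    have "l * sq_norm n c \<le> lambda_min A * sq_norm n c"
      by (intro mult_right_mono sq_norm_nonneg) (simp add: l_def)
    also have "\<dots> \<le> quad_form n K c"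
      unfolding A by (rule lambda_min_hermitian(2)[OF herm(1) assms(3)])
    finally show ?thesis .
  qed
  have lL: "l * sq_norm n c \<le> quad_form n L c" for c
  proof -
    have "l * sq_norm n c \<le> lambda_min B * sq_norm n c"
      by (intro mult_right_mono sq_norm_nonneg) (simp add: l_def)
    also have "\<dots> \<le> quad_form n L c"
      unfolding B by (rule lambda_min_hermitian(2)[OF herm(2) assms(3)])
    finally show ?thesis .
  qed
  have finXY: "finite (X \<union> Y)" "X \<union> Y \<noteq> {}"
    using assms(3,4,7) by (auto simp: lessThan_empty_iff)
  have r_ge: "ip_norm ip z \<le> r" if "z \<in> X \<union> Y" for z
    unfolding assms(12) using finXY that by (intro Max_ge) simp_all
  have "r \<in> ip_norm ip ` (X \<union> Y)"
    unfolding assms(12) using finXY by (intro Max_in) simp_all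
  then have r: "r < 1" "0 \<le> r"
    using assms(6,9) ip_norm_nonneg by (auto simp: open_unit_ball_def)
  have "finite {p. p permutes {..<n}}" by (rule finite_permutations) simp
  moreover have "{p. p permutes {..<n}} \<noteq> {}" using permutes_id by blast
  ultimately have "s \<in> (\<lambda>p. MAX i\<in>{..<n}. ip_norm ip (x i - y (p i))) ` {p. p permutes {..<n}}"
    unfolding s_def symmetric_distance_def
    by (intro Min_in) (rule finite_imageI, assumption, simp only: image_is_empty not_False_eq_True)
  then obtain p where p: "p permutes {..<n}"
    and sp: "s = (MAX i\<in>{..<n}. ip_norm ip (x i - y (p i)))" by auto
  have s_ge: "ip_norm ip (x i - y (p i)) \<le> s" if "i < n" for i
    unfolding sp using that by (intro Max_ge) simp_all
  have V: "x i \<in> V" "y i \<in> V" if "i < n" for i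
    using xball[OF that] yball[OF that] by (simp_all add: open_unit_ball_def)
  have p_lt: "p i < n" if "i < n" for i using permutes_in_image[OF p] that by simp
  have s0: "0 \<le> s"
    using ip_norm_nonneg[of "x 0 - y (p 0)"] s_ge[of 0] V p_lt subspace_diff[OF subspace_V] assms(3)
    by fastforce
  \<comment> \<open>Row \<open>i\<close> of \<open>L'\<close> belongs to \<open>y (p i)\<close>, the
    partner of \<open>x i\<close>; in the given order, \<open>L\<close> may pair points that are far
    apart.\<close>
  define L' where "L' = (\<lambda>i j. L (p i) (p j))"
  define M where "M = 2 * r * s / (1 - r\<^sup>2)\<^sup>2"
  have M0: "0 \<le> M" using r s0 by (simp add: M_def)
  have close: "cmod (K i j - L' i j) \<le> M" if "i < n" "j < n" for i j
    unfolding K_def L'_def L_def M_def using that p_lt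
    by (intro kernel_diff_bound V r_ge s_ge r(1)) (auto simp: assms(4,7))
  then have close': "cmod (L' i j - K i j) \<le> M" if "i < n" "j < n" for i j
    using that by (metis norm_minus_commute)
  have lL': "l * sq_norm n c \<le> quad_form n L' c" for c
    using lL[of "\<lambda>i. c (inv_into UNIV p i)"]
    unfolding L'_def quad_form_permute(1)[OF p, of L c] quad_form_permute(2)[OF p, of c, symmetric] .
  interpret Y': pos_def_finite_rkhs HY n "\<lambda>i. y (p i)" L'
    unfolding L'_def L_def
  proof (rule pos_def_Y)
    show "(\<lambda>i. y (p i)) ` {..<n} = Y"
      using permutes_image[OF p] by (simp only: assms(7) flip: image_image)
    show "inj_on (\<lambda>i. y (p i)) {..<n}"
      using comp_inj_on[OF permutes_inj_on[OF p, of "{..<n}"], of y] assms(8) permutes_image[OF p]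
      by (simp add: comp_def)
  qed
  define e where "e = real n * M / l"
  have "finite_rkhs_pair HX HY n x (\<lambda>i. y (p i)) K L' (1 + e)"
    unfolding e_def
    by unfold_locales (intro quad_form_perturbation[OF close' M0 l lK])
  moreover have "finite_rkhs_pair HY HX n (\<lambda>i. y (p i)) x L' K (1 + e)"
    unfolding e_def
    by unfold_locales (intro quad_form_perturbation[OF close M0 l lL'])
  moreover have e0: "0 \<le> e" using M0 l by (simp add: e_def)
  ultimately have "delta_RK HX HY \<le> ereal (1 + e)" by (intro delta_RK_le) simp_all
  \<comment> \<open>The distance is already at most \<open>1 + e\<close>, which for nonnegative
    \<open>e\<close> lies below the stated square. The 4 in the statement is the 2 in
    \<open>M\<close>, doubled.\<close>
  also have "1 + e \<le> (1 + 2 * e)\<^sup>2" using e0 by (simp add: power2_eq_square algebra_simps)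
  also have "2 * e = 4 * real n * r * (1 - r\<^sup>2) powi (-2) / l * s"
    by (simp add: e_def M_def power_int_def field_simps)
  finally show ?thesis unfolding l_def s_def by simp
qed

end
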